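(* Let $\mathcal{V}_1,\ldots,\mathcal{V}_M$ be vector spaces of functions of separate independent variables, let $\mathcal{T}_1 := \{v_1\otimes\cdots\otimes v_M : v_m\in\mathcal{V}_m \text{ for all } m\}$ be the set of rank-1 tensors, and let $\mathcal{M}\subseteq\mathcal{V}$ be conic and symmetric and satisfy $$\mathcal{T}_1\subseteq\operatorname{cl}(\mathcal{M})\subseteq\mathcal{V}_1\otimes\cdots\otimes\mathcal{V}_M .$$ Let $u\in\mathcal{V}$, and let $u_{\mathcal{M}}\in\arg\min_{v\in\mathcal{M}}\|u-v\|$ and $u_{\langle\mathcal{M}\rangle}\in\arg\min_{v\in\langle\mathcal{M}\rangle}\|u-v\|$ be best approximations of $u$. Then $$\mathfrak{K}_{\{u_{\mathcal{M}}\}-\mathcal{M}} = \mathfrak{K}_{\{u_{\langle\mathcal{M}\rangle}\}-\langle\mathcal{M}\rangle} .$$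
   Context: Let $\rho$ be a probability measure on a set $Y$ and $\|\cdot\| := \|\cdot\|_{L^2(Y,\rho)}$. Let $w$ be a weight function on $Y$, i.e. $w>0$ almost everywhere and $\int_Y w^{-1}\,\mathrm{d}\rho=1$. Define $$\mathcal{V} := \mathcal{V}_{w,\infty} := \{v\in L^\infty(Y,\rho) : \|v\|_{w,\infty}<\infty\},\qquad \|v\|_{w,\infty} := \operatorname{ess\,sup}_{y\in Y}\sqrt{w(y)}\,|v(y)|.$$ Functions are assumed to have point evaluations $v(y)$ at all $y\in Y$; equalities between functions on $Y$ are pointwise. The variation function of a set $A$ of functions is $$\mathfrak{K}_A(y) := \sup_{a\in U(A)}|a(y)|^2,\qquad U(A) := \{a/\|a\| : a\in A\setminus\{0\}\}.$$ $\langle X\rangle$ is the linear span of $X$; $\operatorname{cl}$ is the closure in $\mathcal{V}$; $\{v\}-A=\{v-a:a\in A\}$. Conic means $\lambda x\in\mathcal{M}$ for all $\lambda>0$, $x\in\mathcal{M}$; symmetric means $-\mathcal{M}=\mathcal{M}$. In the tensor setting, $Y$ is a product $Y_1\times\cdots\times Y_M$ with product probability measure $\rho$, elements of $\mathcal{V}_m$ depend only on the $m$-th variable, $(v_1\otimes\cdots\otimes v_M)(y)=v_1(y_1)\cdots v_M(y_M)$, and $\mathcal{V}_1\otimes\cdots\otimes\mathcal{V}_M$ is the linear span of $\mathcal{T}_1$.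
   Formalization: Point evaluations v(y) are assumed to be continuous functionals for the norm ‖·‖_{w,∞} on the space of functions playing the role of V (a linear space of genuine functions); without this continuity the stated equality can fail. *)

theory Defs
  imports "HOL-Probability.Probability" "HOL-Library.Function_Algebras"
begin

(* Pointwise real vector space structure on functions, so that the library's span and
   subspace apply; the additive structure comes from Function_Algebras. *)
instantiation "fun" :: (type, real_vector) real_vector
begin

definition scaleR_fun_def: "scaleR c f = (\<lambda>x. c *\<^sub>R f x)"

instance
  by standard (auto simp: scaleR_fun_def fun_eq_iff scaleR_add_right scaleR_add_left)

end

(* Functions on a set Y are represented by total functions vanishing off Y, so that equality
   in HOL is pointwise equality on Y and these functions form a linear subspace. *)
definition functions_on :: "'b set \<Rightarrow> ('b \<Rightarrow> real) set" where
  "functions_on Y = {f. \<forall>y. y \<notin> Y \<longrightarrow> f y = 0}"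

definition weight_function :: "'b measure \<Rightarrow> ('b \<Rightarrow> real) \<Rightarrow> bool" where
  "weight_function \<rho> w \<longleftrightarrow>
     w \<in> borel_measurable \<rho> \<and> (AE y in \<rho>. 0 < w y) \<and>
     (\<integral>\<^sup>+ y. ennreal (inverse (w y)) \<partial>\<rho>) = 1"

definition wnorm :: "'b measure \<Rightarrow> ('b \<Rightarrow> real) \<Rightarrow> ('b \<Rightarrow> real) \<Rightarrow> ennreal" where
  "wnorm \<rho> w v = esssup \<rho> (\<lambda>y. ennreal (sqrt (w y) * \<bar>v y\<bar>))"

definition L2norm :: "'b measure \<Rightarrow> ('b \<Rightarrow> real) \<Rightarrow> real" where
  "L2norm \<rho> v = sqrt (\<integral>y. (v y)\<^sup>2 \<partial>\<rho>)"

(* The weighted space whose elements are taken from the genuine (everywhere defined)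
   functions in F: one cannot evaluate classes modulo null sets at points. *)
definition wspace ::
    "('b \<Rightarrow> real) set \<Rightarrow> 'b measure \<Rightarrow> ('b \<Rightarrow> real) \<Rightarrow> ('b \<Rightarrow> real) set" where
  "wspace F \<rho> w =
     {v \<in> F. v \<in> borel_measurable \<rho> \<and> esssup \<rho> (\<lambda>y. ennreal \<bar>v y\<bar>) < \<infinity> \<and>
              wnorm \<rho> w v < \<infinity>}"

(* F is a linear space of functions on the sample space such that evaluation at each point
   is a continuous functional for the weighted norm. In particular the norm separates
   elements: wnorm v = 0 only for v = 0. For F = functions_on (space \<rho>) this would force
   every measurable singleton to be non-null, whence the parameter F. *)
definition has_point_evaluations ::
    "('b \<Rightarrow> real) set \<Rightarrow> 'b measure \<Rightarrow> ('b \<Rightarrow> real) \<Rightarrow> bool" where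
  "has_point_evaluations F \<rho> w \<longleftrightarrow>
     subspace F \<and> F \<subseteq> functions_on (space \<rho>) \<and>
     (\<forall>y\<in>space \<rho>. \<exists>C::real. \<forall>v\<in>wspace F \<rho> w. ennreal \<bar>v y\<bar> \<le> ennreal C * wnorm \<rho> w v)"

definition wclosure ::
    "('b \<Rightarrow> real) set \<Rightarrow> 'b measure \<Rightarrow> ('b \<Rightarrow> real) \<Rightarrow> ('b \<Rightarrow> real) set \<Rightarrow> ('b \<Rightarrow> real) set" where
  "wclosure F \<rho> w A =
     {v \<in> wspace F \<rho> w. \<forall>\<epsilon>>0::real. \<exists>a\<in>A. wnorm \<rho> w (v - a) < ennreal \<epsilon>}"

definition normalized :: "'b measure \<Rightarrow> ('b \<Rightarrow> real) set \<Rightarrow> ('b \<Rightarrow> real) set" where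
  "normalized \<rho> A = {(1 / L2norm \<rho> a) *\<^sub>R a | a. a \<in> A - {0}}"

(* Values in [0,\<infinity>], with supremum 0 over the empty set. *)
definition variation :: "'b measure \<Rightarrow> ('b \<Rightarrow> real) set \<Rightarrow> 'b \<Rightarrow> ennreal" where
  "variation \<rho> A y = (SUP a\<in>normalized \<rho> A. ennreal (\<bar>a y\<bar>\<^sup>2))"

(* The library's cone and conic also require closure under the factor 0. *)
definition conic_pos :: "'b::real_vector set \<Rightarrow> bool" where
  "conic_pos A \<longleftrightarrow> (\<forall>c>0. \<forall>x\<in>A. c *\<^sub>R x \<in> A)"

definition symmetric_set :: "'b::real_vector set \<Rightarrow> bool" where
  "symmetric_set A \<longleftrightarrow> uminus ` A = A"

definition best_approximation ::
    "'b measure \<Rightarrow> ('b \<Rightarrow> real) \<Rightarrow> ('b \<Rightarrow> real) set \<Rightarrow> ('b \<Rightarrow> real) \<Rightarrow> bool" where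
  "best_approximation \<rho> u A a \<longleftrightarrow> is_arg_min (\<lambda>v. L2norm \<rho> (u - v)) (\<lambda>v. v \<in> A) a"

(* The tensor product as a function on the product of the spaces of N 1, ..., N d; only the
   values of v m on the space of N m matter. *)
definition tensor ::
    "nat \<Rightarrow> (nat \<Rightarrow> 'a measure) \<Rightarrow> (nat \<Rightarrow> 'a \<Rightarrow> real) \<Rightarrow> (nat \<Rightarrow> 'a) \<Rightarrow> real" where
  "tensor d N v = (\<lambda>y. if y \<in> space (PiM {1..d} N) then \<Prod>m\<in>{1..d}. v m (y m) else 0)"

definition rank1_tensors ::
    "nat \<Rightarrow> (nat \<Rightarrow> 'a measure) \<Rightarrow> (nat \<Rightarrow> ('a \<Rightarrow> real) set) \<Rightarrow> ((nat \<Rightarrow> 'a) \<Rightarrow> real) set" where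
  "rank1_tensors d N V = {tensor d N v | v. \<forall>m\<in>{1..d}. v m \<in> V m}"

definition tensor_space ::
    "nat \<Rightarrow> (nat \<Rightarrow> 'a measure) \<Rightarrow> (nat \<Rightarrow> ('a \<Rightarrow> real) set) \<Rightarrow> ((nat \<Rightarrow> 'a) \<Rightarrow> real) set" where
  "tensor_space d N V = span (rank1_tensors d N V)"

end

theory Submission
  imports Defs
begin

text \<open>Both variation functions are squeezed between that of the rank-1 tensors and that of the
  tensor product. Since \<open>\<integral> 1/w = 1\<close>, the weighted norm dominates the \<open>L\<^sup>2\<close> norm, and together
  with the continuity of point evaluations this lets \<open>|v y|\<^sup>2 / \<parallel>v\<parallel>\<^sup>2\<close> pass to limits in the
  closure of the cone; as \<open>u\<^sub>M - c a\<close> points in the direction of \<open>- a\<close> for large \<open>c\<close>, the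
  shifted cone has at least the variation of the rank-1 tensors. Conversely, the squared value of
  an element of the tensor product at \<open>y\<close> is at most the product of the one-dimensional
  variations at the \<open>y\<^sub>m\<close> times its squared norm, by freezing one variable at a time, and this
  product is already the variation of the rank-1 tensors.\<close>

section \<open>The weighted space\<close>

lemma AE_le_if_wnorm_le:
  assumes "wnorm \<rho> w v \<le> ennreal C" "0 \<le> C"
  shows "AE y in \<rho>. sqrt (w y) * \<bar>v y\<bar> \<le> C"
proof -
  have "AE y in \<rho>. ennreal (sqrt (w y) * \<bar>v y\<bar>) \<le> wnorm \<rho> w v"
    unfolding wnorm_def by (rule esssup_AE)
  then show ?thesis
  proof eventually_elim
    case (elim y)
    then have "ennreal (sqrt (w y) * \<bar>v y\<bar>) \<le> ennreal C"
      using assms(1) by (rule order_trans)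
    then show ?case using assms(2) by simp
  qed
qed

locale weighted_functions =
  fixes \<rho> :: "'b measure" and w :: "'b \<Rightarrow> real" and F :: "('b \<Rightarrow> real) set"
  assumes weight: "weight_function \<rho> w"
    and point_evaluations: "has_point_evaluations F \<rho> w"
begin

lemma measurable_w [measurable]: "w \<in> borel_measurable \<rho>"
  and w_pos: "AE y in \<rho>. 0 < w y"
  and nn_integral_inverse_w: "(\<integral>\<^sup>+ y. ennreal (inverse (w y)) \<partial>\<rho>) = 1"
  using weight by (auto simp: weight_function_def)

lemma has_bochner_integral_inverse_w: "has_bochner_integral \<rho> (\<lambda>y. inverse (w y)) 1"
  by (rule has_bochner_integral_nn_integral)
     (use w_pos nn_integral_inverse_w in auto)

lemma wnorm_le:
  assumes [measurable]: "v \<in> borel_measurable \<rho>" and "AE y in \<rho>. sqrt (w y) * \<bar>v y\<bar> \<le> C"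
  shows "wnorm \<rho> w v \<le> ennreal C"
  unfolding wnorm_def
  by (rule esssup_I) (use assms(2) in \<open>auto elim!: eventually_mono intro: ennreal_leI\<close>)

lemma subspace_F: "subspace F"
  and zero_outside_space: "v \<in> F \<Longrightarrow> y \<notin> space \<rho> \<Longrightarrow> v y = 0"
  using point_evaluations by (auto simp: has_point_evaluations_def functions_on_def)

text \<open>Trades the two essential suprema for real almost-everywhere bounds, which add, scale and
  integrate without arithmetic in \<open>ennreal\<close>.\<close>

lemma wspace_iff:
  "v \<in> wspace F \<rho> w \<longleftrightarrow> v \<in> F \<and> v \<in> borel_measurable \<rho> \<and>
     (\<exists>C\<ge>0. AE y in \<rho>. \<bar>v y\<bar> \<le> C) \<and> (\<exists>C\<ge>0. AE y in \<rho>. sqrt (w y) * \<bar>v y\<bar> \<le> C)"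
proof (cases "v \<in> F \<and> v \<in> borel_measurable \<rho>")
  case True
  then have [measurable]: "v \<in> borel_measurable \<rho>" by simp
  have "esssup \<rho> (\<lambda>y. ennreal (g y)) < \<infinity> \<longleftrightarrow> (\<exists>C\<ge>0. AE y in \<rho>. g y \<le> C)"
    if [measurable]: "g \<in> borel_measurable \<rho>" for g
  proof
    assume "esssup \<rho> (\<lambda>y. ennreal (g y)) < \<infinity>"
    then obtain C where C: "esssup \<rho> (\<lambda>y. ennreal (g y)) = ennreal C" "0 \<le> C"
      by (cases "esssup \<rho> (\<lambda>y. ennreal (g y))") auto
    have "AE y in \<rho>. ennreal (g y) \<le> ennreal C"
      using esssup_AE[of "\<lambda>y. ennreal (g y)" \<rho>] C by simp
    then show "\<exists>C\<ge>0. AE y in \<rho>. g y \<le> C"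
      using C(2) by (intro exI[of _ C]) (auto elim!: eventually_mono)
  next
    assume "\<exists>C\<ge>0. AE y in \<rho>. g y \<le> C"
    then obtain C where "AE y in \<rho>. g y \<le> C" by auto
    then have "esssup \<rho> (\<lambda>y. ennreal (g y)) \<le> ennreal C"
      by (intro esssup_I) (auto elim!: eventually_mono intro: ennreal_leI)
    also have "\<dots> < \<infinity>" by simp
    finally show "esssup \<rho> (\<lambda>y. ennreal (g y)) < \<infinity>" .
  qed
  note this[of "\<lambda>y. \<bar>v y\<bar>"] this[of "\<lambda>y. sqrt (w y) * \<bar>v y\<bar>"]
  with True show ?thesis by (simp add: wspace_def wnorm_def)
qed (auto simp: wspace_def)

lemma subspace_wspace: "subspace (wspace F \<rho> w)"
  unfolding subspace_def
proof (intro conjI ballI allI)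
  show "0 \<in> wspace F \<rho> w"
    using subspace_0[OF subspace_F] by (auto simp: wspace_iff zero_fun_def)
next
  fix f g assume "f \<in> wspace F \<rho> w" "g \<in> wspace F \<rho> w"
  then obtain A B C D where *: "f \<in> F" "f \<in> borel_measurable \<rho>" "g \<in> F" "g \<in> borel_measurable \<rho>"
    "0 \<le> A" "AE y in \<rho>. \<bar>f y\<bar> \<le> A" "0 \<le> B" "AE y in \<rho>. \<bar>g y\<bar> \<le> B"
    "0 \<le> C" "AE y in \<rho>. sqrt (w y) * \<bar>f y\<bar> \<le> C" "0 \<le> D" "AE y in \<rho>. sqrt (w y) * \<bar>g y\<bar> \<le> D"
    unfolding wspace_iff by blast
  have "AE y in \<rho>. \<bar>(f + g) y\<bar> \<le> A + B"
    using *(6,8) by eventually_elim auto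
  moreover have "AE y in \<rho>. sqrt (w y) * \<bar>(f + g) y\<bar> \<le> C + D"
    using *(10,12) w_pos
  proof eventually_elim
    case (elim y)
    then have "sqrt (w y) * \<bar>(f + g) y\<bar> \<le> sqrt (w y) * (\<bar>f y\<bar> + \<bar>g y\<bar>)"
      by (intro mult_left_mono) auto
    with elim show ?case by (simp add: distrib_left)
  qed
  moreover have "f + g \<in> F" "f + g \<in> borel_measurable \<rho>"
    using * subspace_add[OF subspace_F] by (auto simp: plus_fun_def)
  moreover have "0 \<le> A + B" "0 \<le> C + D" using * by auto
  ultimately show "f + g \<in> wspace F \<rho> w"
    unfolding wspace_iff by blast
next
  fix c f assume "f \<in> wspace F \<rho> w"
  then obtain A C where *: "f \<in> F" "f \<in> borel_measurable \<rho>"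
    "0 \<le> A" "AE y in \<rho>. \<bar>f y\<bar> \<le> A" "0 \<le> C" "AE y in \<rho>. sqrt (w y) * \<bar>f y\<bar> \<le> C"
    unfolding wspace_iff by blast
  have "AE y in \<rho>. \<bar>(c *\<^sub>R f) y\<bar> \<le> \<bar>c\<bar> * A"
    using *(4) by eventually_elim (auto simp: scaleR_fun_def abs_mult intro: mult_left_mono)
  moreover have "AE y in \<rho>. sqrt (w y) * \<bar>(c *\<^sub>R f) y\<bar> \<le> \<bar>c\<bar> * C"
    using *(6)
  proof eventually_elim
    case (elim y)
    then have "\<bar>c\<bar> * (sqrt (w y) * \<bar>f y\<bar>) \<le> \<bar>c\<bar> * C"
      by (intro mult_left_mono) auto
    then show ?case by (simp add: scaleR_fun_def abs_mult ac_simps)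
  qed
  moreover have "c *\<^sub>R f \<in> F" "c *\<^sub>R f \<in> borel_measurable \<rho>"
    using * subspace_scale[OF subspace_F] by (auto simp: scaleR_fun_def)
  moreover have "0 \<le> \<bar>c\<bar> * A" "0 \<le> \<bar>c\<bar> * C" using * by auto
  ultimately show "c *\<^sub>R f \<in> wspace F \<rho> w"
    unfolding wspace_iff by blast
qed

text \<open>The majorant has integral \<open>C\<^sup>2\<close> because \<open>inverse (w y)\<close>
  integrates to 1; this is how the weighted norm dominates the L2 norm.\<close>

lemma square_le_inverse_w:
  assumes "AE y in \<rho>. sqrt (w y) * \<bar>v y\<bar> \<le> C"
  shows "AE y in \<rho>. (v y)\<^sup>2 \<le> C\<^sup>2 * inverse (w y)"
  using assms w_pos
proof eventually_elim
  case (elim y)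
  then have "(sqrt (w y) * \<bar>v y\<bar>)\<^sup>2 \<le> C\<^sup>2"
    by (intro power_mono) auto
  with elim show ?case by (simp add: field_simps power_mult_distrib)
qed

lemma integrable_square:
  assumes "v \<in> wspace F \<rho> w"
  shows "integrable \<rho> (\<lambda>y. (v y)\<^sup>2)"
proof -
  from assms obtain C where [measurable]: "v \<in> borel_measurable \<rho>"
    and C: "AE y in \<rho>. sqrt (w y) * \<bar>v y\<bar> \<le> C"
    unfolding wspace_iff by blast
  have "integrable \<rho> (\<lambda>y. C\<^sup>2 * inverse (w y))"
    using has_bochner_integral_inverse_w by (auto simp: has_bochner_integral_iff)
  then show ?thesis
    by (rule Bochner_Integration.integrable_bound)
       (use square_le_inverse_w[OF C] w_pos in \<open>auto elim: eventually_elim2\<close>)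
qed

lemma nn_integral_square:
  assumes "v \<in> wspace F \<rho> w"
  shows "(\<integral>\<^sup>+ y. ennreal ((v y)\<^sup>2) \<partial>\<rho>) = ennreal ((L2norm \<rho> v)\<^sup>2)"
  using nn_integral_eq_integral[OF integrable_square[OF assms]] by (simp add: L2norm_def)

text \<open>A vanishing L2 norm gives zero only almost everywhere. That makes the weighted norm
  vanish, and continuity of point evaluations then yields zero at every point of the space; off the
  space, members of \<open>F\<close> vanish by convention.\<close>

lemma L2norm_eq_0_iff:
  assumes "v \<in> wspace F \<rho> w"
  shows "L2norm \<rho> v = 0 \<longleftrightarrow> v = 0"
proof
  assume "L2norm \<rho> v = 0"
  then have "(\<integral>y. (v y)\<^sup>2 \<partial>\<rho>) = 0" by (simp add: L2norm_def)
  then have "AE y in \<rho>. (v y)\<^sup>2 = 0"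
    by (subst (asm) integral_nonneg_eq_0_iff_AE[OF integrable_square[OF assms]]) auto
  then have "AE y in \<rho>. sqrt (w y) * \<bar>v y\<bar> \<le> 0"
    by (auto elim!: eventually_mono)
  then have 0: "wnorm \<rho> w v = 0"
    using wnorm_le[of v 0] assms by (auto simp: wspace_iff)
  show "v = 0"
  proof
    fix y
    show "v y = 0 y"
    proof (cases "y \<in> space \<rho>")
      case True
      then obtain C where "\<forall>v\<in>wspace F \<rho> w. ennreal \<bar>v y\<bar> \<le> ennreal C * wnorm \<rho> w v"
        using point_evaluations by (auto simp: has_point_evaluations_def)
      with assms 0 show ?thesis by fastforce
    next
      case False
      with assms show ?thesis by (auto simp: wspace_iff zero_outside_space)
    qed
  qed
qed (simp add: L2norm_def)

text \<open>In the factorisation of a difference of squares into \<open>g - f\<close> and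
  \<open>g + f\<close>, each factor absorbs one \<open>sqrt (w y)\<close>. The second is bounded
  through |g + f| \<le> |g - f| + 2 |f|, whence \<open>2 * T + e\<close>. The remaining
  \<open>inverse (w y)\<close> integrates to 1.\<close>

lemma integral_square_diff_le:
  assumes f: "f \<in> wspace F \<rho> w" and g: "g \<in> wspace F \<rho> w"
    and "0 \<le> T" "0 \<le> e" "wnorm \<rho> w f \<le> ennreal T" "wnorm \<rho> w (g - f) \<le> ennreal e"
  shows "\<bar>(\<integral>y. (g y)\<^sup>2 \<partial>\<rho>) - (\<integral>y. (f y)\<^sup>2 \<partial>\<rho>)\<bar> \<le> e * (2 * T + e)"
proof -
  have T: "AE y in \<rho>. sqrt (w y) * \<bar>f y\<bar> \<le> T" and e: "AE y in \<rho>. sqrt (w y) * \<bar>(g - f) y\<bar> \<le> e"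
    using assms AE_le_if_wnorm_le by blast+
  have int: "integrable \<rho> (\<lambda>y. (g y)\<^sup>2 - (f y)\<^sup>2)"
    using integrable_square f g by simp
  have *: "AE y in \<rho>. \<bar>(g y)\<^sup>2 - (f y)\<^sup>2\<bar> \<le> e * (2 * T + e) * inverse (w y)"
    using T e w_pos
  proof eventually_elim
    case (elim y)
    have "sqrt (w y) * \<bar>g y + f y\<bar> \<le> sqrt (w y) * (\<bar>g y - f y\<bar> + 2 * \<bar>f y\<bar>)"
      using elim by (intro mult_left_mono) auto
    also have "\<dots> \<le> 2 * T + e"
      using elim by (simp add: distrib_left)
    finally have "(sqrt (w y) * \<bar>g y - f y\<bar>) * (sqrt (w y) * \<bar>g y + f y\<bar>) \<le> e * (2 * T + e)"
      using elim assms(4) by (intro mult_mono) auto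
    moreover have "(sqrt (w y) * \<bar>g y - f y\<bar>) * (sqrt (w y) * \<bar>g y + f y\<bar>) = w y * \<bar>(g y)\<^sup>2 - (f y)\<^sup>2\<bar>"
      using elim by (simp add: power2_eq_square square_diff_square_factored abs_mult ac_simps flip: real_sqrt_mult)
    ultimately show ?case using elim by (simp add: field_simps)
  qed
  have "\<bar>(\<integral>y. (g y)\<^sup>2 \<partial>\<rho>) - (\<integral>y. (f y)\<^sup>2 \<partial>\<rho>)\<bar> = \<bar>\<integral>y. (g y)\<^sup>2 - (f y)\<^sup>2 \<partial>\<rho>\<bar>"
    using integrable_square f g by simp
  also have "\<dots> \<le> (\<integral>y. \<bar>(g y)\<^sup>2 - (f y)\<^sup>2\<bar> \<partial>\<rho>)"
    by (rule integral_abs_bound)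
  also have "\<dots> \<le> (\<integral>y. e * (2 * T + e) * inverse (w y) \<partial>\<rho>)"
    using has_bochner_integral_inverse_w * int
    by (intro integral_mono_AE) (auto simp: has_bochner_integral_iff)
  also have "\<dots> = e * (2 * T + e)"
    using has_bochner_integral_inverse_w by (auto simp: has_bochner_integral_iff)
  finally show ?thesis .
qed

text \<open>Convergence in the weighted norm controls both numerator and denominator of a normalised
  point value. The real majorant \<open>e\<close> stands in for the \<open>ennreal\<close>-valued
  distances.\<close>

lemma
  assumes f: "f \<in> wspace F \<rho> w" and g: "\<And>n. g n \<in> wspace F \<rho> w"
    and le: "\<And>n::nat. wnorm \<rho> w (g n - f) \<le> ennreal (e n)"
    and e: "e \<longlonglongrightarrow> 0" "\<And>n. 0 \<le> e n"
  shows tendsto_L2norm: "(\<lambda>n. L2norm \<rho> (g n)) \<longlonglongrightarrow> L2norm \<rho> f"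
    and tendsto_point_evaluation: "y \<in> space \<rho> \<Longrightarrow> (\<lambda>n. g n y) \<longlonglongrightarrow> f y"
proof -
  from f obtain T where T: "wnorm \<rho> w f \<le> ennreal T" "0 \<le> T"
    unfolding wspace_def by (cases "wnorm \<rho> w f") auto
  have "(\<lambda>n. e n * (2 * T + e n)) \<longlonglongrightarrow> 0 * (2 * T + 0)"
    by (intro tendsto_intros e)
  then have "(\<lambda>n. e n * (2 * T + e n)) \<longlonglongrightarrow> 0" by simp
  moreover have "norm ((\<integral>y. (g n y)\<^sup>2 \<partial>\<rho>) - (\<integral>y. (f y)\<^sup>2 \<partial>\<rho>)) \<le> e n * (2 * T + e n)" for n
    unfolding real_norm_def by (rule integral_square_diff_le[OF f g T(2) e(2) T(1) le])
  ultimately have "(\<lambda>n. (\<integral>y. (g n y)\<^sup>2 \<partial>\<rho>) - (\<integral>y. (f y)\<^sup>2 \<partial>\<rho>)) \<longlonglongrightarrow> 0"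
    by (rule Lim_null_comparison[OF always_eventually[OF allI], rotated])
  then have "(\<lambda>n. \<integral>y. (g n y)\<^sup>2 \<partial>\<rho>) \<longlonglongrightarrow> (\<integral>y. (f y)\<^sup>2 \<partial>\<rho>)"
    by (rule LIM_zero_cancel)
  then show "(\<lambda>n. L2norm \<rho> (g n)) \<longlonglongrightarrow> L2norm \<rho> f"
    unfolding L2norm_def by (rule tendsto_real_sqrt)
  assume "y \<in> space \<rho>"
  then obtain C where C: "\<And>v. v \<in> wspace F \<rho> w \<Longrightarrow> ennreal \<bar>v y\<bar> \<le> ennreal C * wnorm \<rho> w v"
    using point_evaluations unfolding has_point_evaluations_def by blast
  \<comment> \<open>The evaluation constant may be negative, in which case \<open>ennreal C\<close>
    is 0; the absolute value is a valid majorant in either case.\<close>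
  have bound: "norm (g n y - f y) \<le> \<bar>C\<bar> * e n" for n
  proof -
    have "ennreal \<bar>(g n - f) y\<bar> \<le> ennreal C * wnorm \<rho> w (g n - f)"
      using C subspace_diff[OF subspace_wspace g f] by blast
    also have "\<dots> \<le> ennreal \<bar>C\<bar> * ennreal (e n)"
      by (intro mult_mono le ennreal_leI) auto
    finally show ?thesis using e(2)[of n] by (simp flip: ennreal_mult)
  qed
  have "(\<lambda>n. \<bar>C\<bar> * e n) \<longlonglongrightarrow> \<bar>C\<bar> * 0"
    by (intro tendsto_intros e)
  then have "(\<lambda>n. \<bar>C\<bar> * e n) \<longlonglongrightarrow> 0" by simp
  with bound have "(\<lambda>n. g n y - f y) \<longlonglongrightarrow> 0"
    by (rule Lim_null_comparison[OF always_eventually[OF allI]])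
  then show "(\<lambda>n. g n y) \<longlonglongrightarrow> f y"
    by (rule LIM_zero_cancel)
qed

end

section \<open>Variation functions and shifted cones\<close>

lemma L2norm_scaleR: "L2norm \<rho> (c *\<^sub>R v) = \<bar>c\<bar> * L2norm \<rho> v"
  by (simp add: L2norm_def scaleR_fun_def power_mult_distrib real_sqrt_mult)

lemma variation_mono: "A \<subseteq> B \<Longrightarrow> variation \<rho> A y \<le> variation \<rho> B y"
  unfolding variation_def normalized_def by (intro SUP_subset_mono) auto

lemma variation_upper:
  assumes "a \<in> A" "a \<noteq> 0"
  shows "ennreal ((a y / L2norm \<rho> a)\<^sup>2) \<le> variation \<rho> A y"
  unfolding variation_def normalized_def
  by (rule SUP_upper2[where i = "(1 / L2norm \<rho> a) *\<^sub>R a"]) (use assms in \<open>auto simp: scaleR_fun_def power_divide\<close>)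

context weighted_functions
begin

text \<open>Conicity makes the shift negligible: \<open>x - c a\<close> with \<open>a\<close> close to \<open>t\<close> and \<open>c\<close> large is,
  up to normalisation, close to \<open>- t\<close>.\<close>

lemma variation_shifted_cone_ge:
  assumes "A \<subseteq> wspace F \<rho> w" "conic_pos A" and x: "x \<in> wspace F \<rho> w"
    and t: "t \<in> wclosure F \<rho> w A" "L2norm \<rho> t = 1" and y: "y \<in> space \<rho>"
  shows "ennreal ((t y)\<^sup>2) \<le> variation \<rho> ((\<lambda>v. x - v) ` A) y"
proof -
  have tw: "t \<in> wspace F \<rho> w" using t by (simp add: wclosure_def)
  have "\<exists>a\<in>A. wnorm \<rho> w (t - a) < ennreal (1 / real (Suc n))" for n
    using t(1) by (auto simp: wclosure_def simp del: of_nat_Suc)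
  then obtain a where a: "\<And>n. a n \<in> A" "\<And>n. wnorm \<rho> w (t - a n) < ennreal (1 / real (Suc n))"
    by metis
  from x obtain T where T: "0 \<le> T" "AE y in \<rho>. sqrt (w y) * \<bar>x y\<bar> \<le> T"
    unfolding wspace_iff by blast
  \<comment> \<open>\<open>b n\<close> is \<open>x - (n+1) a n\<close> divided by
    \<open>n+1\<close>, so it is proportional to a member of the shifted cone. It differs from
    \<open>- t\<close> by \<open>x / (n+1) + (t - a n)\<close>; the two summands contribute
    \<open>T\<close> and \<open>1\<close> to the numerator of \<open>e n\<close>.\<close>
  define b where "b n = (1 / real (Suc n)) *\<^sub>R x - a n" for n
  define e where "e n = (T + 1) / real (Suc n)" for n
  have aw: "a n \<in> wspace F \<rho> w" for n using a assms by auto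
  have bw: "b n \<in> wspace F \<rho> w" for n
    unfolding b_def by (intro subspace_diff subspace_scale subspace_wspace x aw)
  have ntw: "- t \<in> wspace F \<rho> w" by (intro subspace_neg subspace_wspace tw)
  have "wnorm \<rho> w (b n - - t) \<le> ennreal (e n)" for n
  proof (rule wnorm_le)
    show "b n - - t \<in> borel_measurable \<rho>"
      using subspace_diff[OF subspace_wspace bw ntw] wspace_iff by blast
    have "AE y in \<rho>. sqrt (w y) * \<bar>(t - a n) y\<bar> \<le> 1 / real (Suc n)"
      by (intro AE_le_if_wnorm_le less_imp_le a(2)) simp
    with T(2) w_pos show "AE y in \<rho>. sqrt (w y) * \<bar>(b n - - t) y\<bar> \<le> e n"
    proof eventually_elim
      case (elim y)
      have "(b n - - t) y = x y / real (Suc n) + (t - a n) y"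
        by (simp add: b_def scaleR_fun_def)
      then have "\<bar>(b n - - t) y\<bar> \<le> \<bar>x y\<bar> / real (Suc n) + \<bar>(t - a n) y\<bar>"
        using abs_triangle_ineq[of "x y / real (Suc n)" "(t - a n) y"] by simp
      then have "sqrt (w y) * \<bar>(b n - - t) y\<bar> \<le> sqrt (w y) * (\<bar>x y\<bar> / real (Suc n) + \<bar>(t - a n) y\<bar>)"
        using elim by (intro mult_left_mono) auto
      also have "\<dots> = (sqrt (w y) * \<bar>x y\<bar>) / real (Suc n) + sqrt (w y) * \<bar>(t - a n) y\<bar>"
        by (simp add: distrib_left)
      also have "\<dots> \<le> T / real (Suc n) + 1 / real (Suc n)"
        using elim by (intro add_mono divide_right_mono) auto
      finally show ?case by (simp add: e_def add_divide_distrib)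
    qed
  qed
  note lim = ntw bw this
  have e: "e \<longlonglongrightarrow> 0"
    unfolding e_def by (rule lim_const_over_n[THEN LIMSEQ_Suc])
  have e0: "0 \<le> e n" for n using T by (simp add: e_def)
  have "L2norm \<rho> (- t) = 1"
    using L2norm_scaleR[of \<rho> "-1" t] t by simp
  then have norm: "(\<lambda>n. L2norm \<rho> (b n)) \<longlonglongrightarrow> 1"
    using tendsto_L2norm[OF lim e e0] by simp
  have "(\<lambda>n. (b n y / L2norm \<rho> (b n))\<^sup>2) \<longlonglongrightarrow> ((- t) y / 1)\<^sup>2"
    by (intro tendsto_intros norm tendsto_point_evaluation[OF lim e e0 y]) auto
  then have "(\<lambda>n. ennreal ((b n y / L2norm \<rho> (b n))\<^sup>2)) \<longlonglongrightarrow> ennreal ((t y)\<^sup>2)"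
    by (intro tendsto_ennrealI) simp
  \<comment> \<open>The norms tend to 1, so \<open>b n\<close> is eventually nonzero and its
    normalisation is a genuine member of the normalised set.\<close>
  moreover have "\<forall>\<^sub>F n in sequentially. L2norm \<rho> (b n) > 0"
    using norm by (rule order_tendstoD) simp
  then have "\<forall>\<^sub>F n in sequentially.
    ennreal ((b n y / L2norm \<rho> (b n))\<^sup>2) \<le> variation \<rho> ((\<lambda>v. x - v) ` A) y"
  proof eventually_elim
    case (elim n)
    \<comment> \<open>Undoing the division by \<open>n+1\<close> returns to the shifted cone, and
      the normalised value does not notice positive scaling.\<close>
    let ?c = "real (Suc n) *\<^sub>R b n"
    have "?c = x - real (Suc n) *\<^sub>R a n"
      by (simp add: b_def scaleR_diff_right del: of_nat_Suc)
    moreover have "real (Suc n) *\<^sub>R a n \<in> A"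
      using assms(2) a(1) by (auto simp: conic_pos_def)
    ultimately have mem: "?c \<in> (\<lambda>v. x - v) ` A"
      by (metis imageI)
    have "L2norm \<rho> ?c = real (Suc n) * L2norm \<rho> (b n)"
      by (simp add: L2norm_scaleR)
    with elim have "?c \<noteq> 0"
      by (auto simp: L2norm_def)
    with mem have "ennreal ((?c y / L2norm \<rho> ?c)\<^sup>2) \<le> variation \<rho> ((\<lambda>v. x - v) ` A) y"
      by (rule variation_upper)
    moreover have "?c y / L2norm \<rho> ?c = b n y / L2norm \<rho> (b n)"
      unfolding L2norm_scaleR by (simp add: scaleR_fun_def del: of_nat_Suc)
    ultimately show ?case by simp
  qed
  ultimately show ?thesis
    by (rule tendsto_upperbound) simp
qed

text \<open>The squared norm of a nonzero function in the weighted space is a positive finite real,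
  so dividing by it is harmless even when \<open>K\<close> is infinite.\<close>

lemma variation_le:
  assumes "A \<subseteq> wspace F \<rho> w"
    and "\<And>f. f \<in> A \<Longrightarrow> ennreal ((f y)\<^sup>2) \<le> K * (\<integral>\<^sup>+ x. ennreal ((f x)\<^sup>2) \<partial>\<rho>)"
  shows "variation \<rho> A y \<le> K"
  unfolding variation_def
proof (rule SUP_least)
  fix g assume "g \<in> normalized \<rho> A"
  then obtain f where f: "f \<in> A" "f \<noteq> 0" "g = (1 / L2norm \<rho> f) *\<^sub>R f"
    by (auto simp: normalized_def)
  have fw: "f \<in> wspace F \<rho> w" using assms f by auto
  then have pos: "0 < (L2norm \<rho> f)\<^sup>2"
    using f L2norm_eq_0_iff by simp
  have "ennreal (\<bar>g y\<bar>\<^sup>2) = ennreal ((f y)\<^sup>2) / ennreal ((L2norm \<rho> f)\<^sup>2)"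
    using pos by (simp add: f scaleR_fun_def power_divide divide_ennreal)
  also have "\<dots> \<le> K * ennreal ((L2norm \<rho> f)\<^sup>2) / ennreal ((L2norm \<rho> f)\<^sup>2)"
    using assms(2)[OF f(1)] nn_integral_square[OF fw] by (intro divide_right_mono_ennreal) simp
  also have "\<dots> = K"
    using pos by (subst mult_divide_eq_ennreal) auto
  finally show "ennreal (\<bar>g y\<bar>\<^sup>2) \<le> K" .
qed

end

section \<open>Tensor products\<close>

text \<open>Suprema are pulled out one index at a time. The free factor \<open>c\<close> makes the
  induction work: it collects the terms \<open>g i x\<close> of the indices already treated.\<close>

lemma prod_SUP_le_ennreal:
  fixes g :: "'i \<Rightarrow> 'v \<Rightarrow> ennreal"
  assumes "finite I"
    and "\<And>v. (\<And>i. i \<in> I \<Longrightarrow> v i \<in> A i) \<Longrightarrow> (\<Prod>i\<in>I. g i (v i)) * c \<le> K"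
  shows "(\<Prod>i\<in>I. SUP v\<in>A i. g i v) * c \<le> K"
  using assms
proof (induction I arbitrary: c rule: finite_induct)
  case empty
  then show ?case by simp
next
  case (insert i I)
  have "(\<Prod>j\<in>I. SUP v\<in>A j. g j v) * (g i x * c) \<le> K" if x: "x \<in> A i" for x
  proof (rule insert.IH)
    fix v assume v: "\<And>j. j \<in> I \<Longrightarrow> v j \<in> A j"
    have "(\<Prod>j\<in>insert i I. g j ((v(i := x)) j)) * c \<le> K"
      by (rule insert.prems) (use v x in auto)
    moreover have "(\<Prod>j\<in>I. g j ((v(i := x)) j)) = (\<Prod>j\<in>I. g j (v j))"
      using insert.hyps by (intro prod.cong) auto
    ultimately show "(\<Prod>j\<in>I. g j (v j)) * (g i x * c) \<le> K"
      using insert.hyps by (simp add: ac_simps)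
  qed
  then have "(SUP x\<in>A i. g i x * ((\<Prod>j\<in>I. SUP v\<in>A j. g j v) * c)) \<le> K"
    by (intro SUP_least) (simp add: ac_simps)
  then show ?case
    using insert.hyps by (simp add: SUP_mult_right_ennreal[symmetric] mult.assoc)
qed

text \<open>By induction on \<open>I\<close>: freeze coordinate \<open>i\<close> at
  \<open>y i\<close>, apply the induction hypothesis in the other variables, use the slice bound for
  \<open>i\<close> under the integral, and join the two integrals by Tonelli. Since
  \<open>K i\<close> is the same for all base points \<open>x\<close>, it leaves the
  integral.\<close>

lemma (in product_sigma_finite) square_le_prod_slices:
  fixes f :: "('i \<Rightarrow> 'a) \<Rightarrow> real"
  assumes "finite I" "f \<in> borel_measurable (PiM I M)" "y \<in> space (PiM I M)"
    and "\<And>i x. i \<in> I \<Longrightarrow> x \<in> space (PiM I M) \<Longrightarrow>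
           ennreal ((f (x(i := y i)))\<^sup>2) \<le> K i * (\<integral>\<^sup>+ z. ennreal ((f (x(i := z)))\<^sup>2) \<partial>M i)"
  shows "ennreal ((f y)\<^sup>2) \<le> (\<Prod>i\<in>I. K i) * (\<integral>\<^sup>+ x. ennreal ((f x)\<^sup>2) \<partial>PiM I M)"
  using assms
proof (induction I arbitrary: f y rule: finite_induct)
  case empty
  then show ?case by (simp add: nn_integral_empty space_PiM)
next
  case (insert i I)
  note [measurable] = insert.prems(1)
  \<comment> \<open>Points of \<open>space (PiM I M)\<close> must be \<open>undefined\<close>
    outside \<open>I\<close>, hence the restriction; putting \<open>y i\<close> back recovers
    \<open>y\<close>.\<close>
  define y' where "y' = restrict y I"
  have yi: "y i \<in> space (M i)" using insert.prems(2) by (auto simp: space_PiM)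
  have y': "y' \<in> space (PiM I M)" using insert.prems(2) by (auto simp: space_PiM y'_def)
  have y: "y'(i := y i) = y"
    using insert.prems(2) insert.hyps
    by (auto simp: y'_def space_PiM fun_eq_iff PiE_def extensional_def)
  have upd: "x(i := z) \<in> space (PiM (insert i I) M)"
    if "x \<in> space (PiM I M)" "z \<in> space (M i)" for x z
    using that by (auto simp: space_PiM PiE_fun_upd)
  have meas: "(\<lambda>x. f (x(i := y i))) \<in> borel_measurable (PiM I M)"
    by (rule measurable_compose[OF _ insert.prems(1)], rule measurable_fun_upd[where J = I])
       (use yi in auto)
  have "ennreal ((f (y'(i := y i)))\<^sup>2)
      \<le> (\<Prod>j\<in>I. K j) * (\<integral>\<^sup>+ x. ennreal ((f (x(i := y i)))\<^sup>2) \<partial>PiM I M)"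
  proof (rule insert.IH[OF meas y'])
    fix j x assume j: "j \<in> I" and x: "x \<in> space (PiM I M)"
    then have "j \<noteq> i" "y' j = y j" using insert.hyps by (auto simp: y'_def)
    then show "ennreal ((f (x(j := y' j, i := y i)))\<^sup>2)
        \<le> K j * (\<integral>\<^sup>+ z. ennreal ((f (x(j := z, i := y i)))\<^sup>2) \<partial>M j)"
      using insert.prems(3)[of j, OF _ upd[OF x yi]] j by (simp add: fun_upd_twist[OF \<open>j \<noteq> i\<close>] del: fun_upd_apply)
  qed
  also have "\<dots> \<le> (\<Prod>j\<in>I. K j) *
      (\<integral>\<^sup>+ x. K i * (\<integral>\<^sup>+ z. ennreal ((f (x(i := z)))\<^sup>2) \<partial>M i) \<partial>PiM I M)"
  proof (intro mult_left_mono nn_integral_mono)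
    fix x assume x: "x \<in> space (PiM I M)"
    show "ennreal ((f (x(i := y i)))\<^sup>2) \<le> K i * (\<integral>\<^sup>+ z. ennreal ((f (x(i := z)))\<^sup>2) \<partial>M i)"
      using insert.prems(3)[of i, OF _ upd[OF x yi]] by (simp del: fun_upd_apply)
  qed simp
  also have "(\<integral>\<^sup>+ x. K i * (\<integral>\<^sup>+ z. ennreal ((f (x(i := z)))\<^sup>2) \<partial>M i) \<partial>PiM I M)
      = K i * (\<integral>\<^sup>+ x. (\<integral>\<^sup>+ z. ennreal ((f (x(i := z)))\<^sup>2) \<partial>M i) \<partial>PiM I M)"
  proof (rule nn_integral_cmult)
    interpret Mi: sigma_finite_measure "M i" by (rule sigma_finite_measures)
    show "(\<lambda>x. \<integral>\<^sup>+ z. ennreal ((f (x(i := z)))\<^sup>2) \<partial>M i) \<in> borel_measurable (PiM I M)"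
      by measurable
  qed
  also have "(\<integral>\<^sup>+ x. (\<integral>\<^sup>+ z. ennreal ((f (x(i := z)))\<^sup>2) \<partial>M i) \<partial>PiM I M)
      = (\<integral>\<^sup>+ x. ennreal ((f x)\<^sup>2) \<partial>PiM (insert i I) M)"
    using insert.hyps by (intro product_nn_integral_insert[symmetric]) auto
  finally show ?case
    using insert.hyps by (simp add: y ac_simps)
qed

lemma tensor_apply:
  "y \<in> space (PiM {1..d} N) \<Longrightarrow> tensor d N v y = (\<Prod>m\<in>{1..d}. v m (y m))"
  by (simp add: tensor_def)

lemma space_PiM_fun_upd:
  "x \<in> space (PiM I N) \<Longrightarrow> i \<in> I \<Longrightarrow> z \<in> space (N i) \<Longrightarrow> x(i := z) \<in> space (PiM I N)"
  by (auto simp: space_PiM PiE_def extensional_def Pi_iff)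

lemma tensor_fun_upd:
  assumes "x \<in> space (PiM {1..d} N)" "m \<in> {1..d}" "z \<in> space (N m)"
  shows "tensor d N v (x(m := z)) = (\<Prod>j\<in>{1..d} - {m}. v j (x j)) * v m z"
proof -
  have "tensor d N v (x(m := z)) = (\<Prod>j\<in>{1..d}. v j ((x(m := z)) j))"
    using assms by (intro tensor_apply space_PiM_fun_upd)
  also have "\<dots> = v m z * (\<Prod>j\<in>{1..d} - {m}. v j ((x(m := z)) j))"
    using assms by (subst prod.remove[of _ m]) auto
  also have "(\<Prod>j\<in>{1..d} - {m}. v j ((x(m := z)) j)) = (\<Prod>j\<in>{1..d} - {m}. v j (x j))"
    by (intro prod.cong) auto
  finally show ?thesis by (simp only: mult.commute)
qed

text \<open>For a rank-1 tensor the slice is a scalar multiple of its \<open>m\<close>-th factor,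
  and the functions with a slice in \<open>V m\<close> form a subspace, so the property passes to
  the span. Agreement is asked only on \<open>space (N m)\<close>, since tensors ignore other
  values.\<close>

lemma tensor_space_slice:
  assumes V: "subspace (V m)" and f: "f \<in> tensor_space d N V"
    and m: "m \<in> {1..d}" and x: "x \<in> space (PiM {1..d} N)"
  shows "\<exists>v\<in>V m. \<forall>z\<in>space (N m). f (x(m := z)) = v z"
proof -
  define S where "S = {f. \<exists>v\<in>V m. \<forall>z\<in>space (N m). f (x(m := z)) = v z}"
  have "subspace S"
    unfolding subspace_def
  proof (intro conjI ballI allI)
    show "0 \<in> S"
      using subspace_0[OF V] by (auto simp: S_def intro!: bexI[of _ 0])
  next
    fix f g assume "f \<in> S" "g \<in> S"
    then obtain v v' where "v \<in> V m" "v' \<in> V m" "\<forall>z\<in>space (N m). f (x(m := z)) = v z"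
      "\<forall>z\<in>space (N m). g (x(m := z)) = v' z" by (auto simp: S_def)
    then show "f + g \<in> S"
      using subspace_add[OF V, of v v'] by (auto simp: S_def intro!: bexI[of _ "v + v'"])
  next
    fix c f assume "f \<in> S"
    then obtain v where "v \<in> V m" "\<forall>z\<in>space (N m). f (x(m := z)) = v z" by (auto simp: S_def)
    then show "c *\<^sub>R f \<in> S"
      using subspace_scale[OF V, of v c]
      by (auto simp: S_def scaleR_fun_def intro!: bexI[of _ "c *\<^sub>R v"])
  qed
  moreover have "rank1_tensors d N V \<subseteq> S"
  proof
    fix t assume "t \<in> rank1_tensors d N V"
    then obtain v where t: "t = tensor d N v" and v: "v m \<in> V m"
      using m by (auto simp: rank1_tensors_def)
    let ?c = "\<Prod>j\<in>{1..d} - {m}. v j (x j)"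
    have "?c *\<^sub>R v m \<in> V m"
      using V v by (rule subspace_scale)
    then show "t \<in> S"
      using tensor_fun_upd[OF x m] unfolding S_def t
      by (auto simp: scaleR_fun_def intro!: bexI[of _ "?c *\<^sub>R v m"])
  qed
  ultimately show ?thesis
    using span_minimal[of "rank1_tensors d N V" S] f by (auto simp: tensor_space_def S_def)
qed

section \<open>Factors of rank-1 tensors lying in the weighted space\<close>

locale rank1_functions = weighted_functions "PiM {1..d} N" w F
  for d :: nat and N :: "nat \<Rightarrow> 'a measure" and w :: "(nat \<Rightarrow> 'a) \<Rightarrow> real"
    and F :: "((nat \<Rightarrow> 'a) \<Rightarrow> real) set" +
  fixes V :: "nat \<Rightarrow> ('a \<Rightarrow> real) set"
  assumes prob_N: "prob_space (N m)"
    and subspace_V: "m \<in> {1..d} \<Longrightarrow> subspace (V m)"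
    and rank1_subset: "rank1_tensors d N V \<subseteq> wspace F (PiM {1..d} N) w"
begin

sublocale product_prob_space N
  by (rule product_prob_spaceI) (rule prob_N)

lemma tensor_in_wspace:
  "(\<And>m. m \<in> {1..d} \<Longrightarrow> v m \<in> V m) \<Longrightarrow> tensor d N v \<in> wspace F (PiM {1..d} N) w"
  using rank1_subset unfolding rank1_tensors_def by blast

lemma nn_integral_tensor_square:
  assumes "\<And>m. m \<in> {1..d} \<Longrightarrow> v m \<in> borel_measurable (N m)"
  shows "(\<integral>\<^sup>+ x. ennreal ((tensor d N v x)\<^sup>2) \<partial>PiM {1..d} N)
       = (\<Prod>m\<in>{1..d}. \<integral>\<^sup>+ z. ennreal ((v m z)\<^sup>2) \<partial>N m)"
proof -
  have "(\<integral>\<^sup>+ x. ennreal ((tensor d N v x)\<^sup>2) \<partial>PiM {1..d} N)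
      = (\<integral>\<^sup>+ x. (\<Prod>m\<in>{1..d}. ennreal ((v m (x m))\<^sup>2)) \<partial>PiM {1..d} N)"
    by (intro nn_integral_cong) (simp add: tensor_apply prod_ennreal prod_power_distrib)
  also have "\<dots> = (\<Prod>m\<in>{1..d}. \<integral>\<^sup>+ z. ennreal ((v m z)\<^sup>2) \<partial>N m)"
  proof (rule product_nn_integral_prod)
    fix m assume "m \<in> {1..d}"
    note [measurable] = assms[OF this]
    show "(\<lambda>z. ennreal ((v m z)\<^sup>2)) \<in> borel_measurable (N m)" by measurable
  qed simp
  finally show ?thesis .
qed

text \<open>The spaces \<open>V m\<close> come with no measurability or integrability; both are
  extracted from tensors. A rank-1 tensor nonzero at \<open>x0\<close> serves as a probe: put
  \<open>v\<close> in place of \<open>v0 m\<close>, freeze the other variables at \<open>x0\<close>,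
  and divide by the nonzero frozen factors to recover \<open>v\<close>.\<close>

context
  fixes v0 :: "nat \<Rightarrow> 'a \<Rightarrow> real" and x0 :: "nat \<Rightarrow> 'a"
  assumes v0: "\<And>m. m \<in> {1..d} \<Longrightarrow> v0 m \<in> V m"
    and x0: "x0 \<in> space (PiM {1..d} N)"
    and nonzero: "\<And>m. m \<in> {1..d} \<Longrightarrow> v0 m (x0 m) \<noteq> 0"
begin

lemma factor_eq_slice:
  assumes "m \<in> {1..d}" "z \<in> space (N m)"
  shows "v z = tensor d N (v0(m := v)) (x0(m := z)) / (\<Prod>j\<in>{1..d} - {m}. v0 j (x0 j))"
proof -
  have "(\<Prod>j\<in>{1..d} - {m}. (v0(m := v)) j (x0 j)) = (\<Prod>j\<in>{1..d} - {m}. v0 j (x0 j))"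
    by (intro prod.cong) auto
  moreover have "(\<Prod>j\<in>{1..d} - {m}. v0 j (x0 j)) \<noteq> 0"
    using nonzero by (simp add: prod_zero_iff)
  ultimately show ?thesis
    using tensor_fun_upd[OF x0 assms, of "v0(m := v)"] by simp
qed

lemma factor_measurable:
  assumes m: "m \<in> {1..d}" and v: "v \<in> V m"
  shows "v \<in> borel_measurable (N m)"
proof -
  let ?t = "tensor d N (v0(m := v))" and ?J = "{1..d} - {m}"
  have "(v0(m := v)) j \<in> V j" if "j \<in> {1..d}" for j
    using v v0 that by auto
  then have "?t \<in> borel_measurable (PiM {1..d} N)"
    using tensor_in_wspace wspace_iff by blast
  moreover have "(\<lambda>z. x0(m := z)) \<in> measurable (N m) (PiM {1..d} N)"
  proof -
    \<comment> \<open>The update map is measurable from points living on the remaining indices, so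
      coordinate \<open>m\<close> of \<open>x0\<close> is first removed; the update by
      \<open>z\<close> would overwrite it anyway.\<close>
    have "restrict x0 ?J \<in> space (PiM ?J N)"
      using x0 by (auto simp: space_PiM)
    then have "(\<lambda>z. (restrict x0 ?J)(m := z)) \<in> measurable (N m) (PiM (insert m ?J) N)"
      by (rule measurable_component_update) simp
    moreover have "(restrict x0 ?J)(m := z) = x0(m := z)" for z
      using x0 by (auto simp: space_PiM PiE_def extensional_def fun_eq_iff)
    ultimately show ?thesis using m by (simp add: insert_absorb)
  qed
  ultimately have "(\<lambda>z. ?t (x0(m := z))) \<in> borel_measurable (N m)"
    by (rule measurable_compose[where f = "\<lambda>z. x0(m := z)", rotated])
  then have "(\<lambda>z. ?t (x0(m := z)) / (\<Prod>j\<in>?J. v0 j (x0 j))) \<in> borel_measurable (N m)"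
    by (rule borel_measurable_divide) simp
  then show ?thesis
    using factor_eq_slice[OF m] by (subst measurable_cong) auto
qed

text \<open>Norms of tensors factorise. The factors stay nonnegative integrals because their
  finiteness is not yet known, while the tensor already has a real norm.\<close>

lemma nn_integral_tensor_fun_upd_square:
  assumes m: "m \<in> {1..d}" and v: "v \<in> V m"
  shows "(\<integral>\<^sup>+ z. ennreal ((v z)\<^sup>2) \<partial>N m) * (\<Prod>j\<in>{1..d} - {m}. \<integral>\<^sup>+ z. ennreal ((v0 j z)\<^sup>2) \<partial>N j)
       = ennreal ((L2norm (PiM {1..d} N) (tensor d N (v0(m := v))))\<^sup>2)"
proof -
  have mem: "(v0(m := v)) j \<in> V j" if "j \<in> {1..d}" for j
    using v v0 that by auto
  have "ennreal ((L2norm (PiM {1..d} N) (tensor d N (v0(m := v))))\<^sup>2)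
      = (\<Prod>j\<in>{1..d}. \<integral>\<^sup>+ z. ennreal (((v0(m := v)) j z)\<^sup>2) \<partial>N j)"
    using nn_integral_square[OF tensor_in_wspace[OF mem]]
      nn_integral_tensor_square[OF factor_measurable[OF _ mem]] by (simp del: fun_upd_apply)
  also have "\<dots> = (\<integral>\<^sup>+ z. ennreal ((v z)\<^sup>2) \<partial>N m) *
      (\<Prod>j\<in>{1..d} - {m}. \<integral>\<^sup>+ z. ennreal (((v0(m := v)) j z)\<^sup>2) \<partial>N j)"
    using m by (subst prod.remove[of _ m]) auto
  also have "(\<Prod>j\<in>{1..d} - {m}. \<integral>\<^sup>+ z. ennreal (((v0(m := v)) j z)\<^sup>2) \<partial>N j)
      = (\<Prod>j\<in>{1..d} - {m}. \<integral>\<^sup>+ z. ennreal ((v0 j z)\<^sup>2) \<partial>N j)"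
    by (intro prod.cong) auto
  finally show ?thesis ..
qed

text \<open>A null factor makes the probing tensor have norm zero, hence vanish at every point, and
  \<open>v\<close> is a multiple of one of its slices.\<close>

lemma factor_eq_0:
  assumes m: "m \<in> {1..d}" and v: "v \<in> V m"
    and 0: "(\<integral>\<^sup>+ z. ennreal ((v z)\<^sup>2) \<partial>N m) = 0" and z: "z \<in> space (N m)"
  shows "v z = 0"
proof -
  have "tensor d N (v0(m := v)) \<in> wspace F (PiM {1..d} N) w"
    by (rule tensor_in_wspace) (use v v0 in auto)
  moreover have "L2norm (PiM {1..d} N) (tensor d N (v0(m := v))) = 0"
    using nn_integral_tensor_fun_upd_square[OF m v] 0 by simp
  ultimately have "tensor d N (v0(m := v)) = 0"
    using L2norm_eq_0_iff by blast
  then show ?thesis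
    using factor_eq_slice[OF m z, of v] by simp
qed

text \<open>The other probe factors have nonzero norm because they do not vanish at
  \<open>x0\<close>; an infinite norm of \<open>v\<close> would then make the finite tensor norm
  infinite.\<close>

lemma factor_square_finite:
  assumes m: "m \<in> {1..d}" and v: "v \<in> V m"
  shows "(\<integral>\<^sup>+ z. ennreal ((v z)\<^sup>2) \<partial>N m) \<noteq> \<infinity>"
proof
  have "(\<integral>\<^sup>+ z. ennreal ((v0 j z)\<^sup>2) \<partial>N j) \<noteq> 0" if "j \<in> {1..d}" for j
    using factor_eq_0[OF that v0[OF that], of "x0 j"] nonzero[OF that] x0 that
    by (auto simp: space_PiM PiE_iff)
  then have "(\<Prod>j\<in>{1..d} - {m}. \<integral>\<^sup>+ z. ennreal ((v0 j z)\<^sup>2) \<partial>N j) \<noteq> 0"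
    by (simp add: prod_zero_iff)
  moreover assume "(\<integral>\<^sup>+ z. ennreal ((v z)\<^sup>2) \<partial>N m) = \<infinity>"
  ultimately show False
    using nn_integral_tensor_fun_upd_square[OF m v] by (simp add: ennreal_top_mult)
qed

text \<open>Homogeneity: either the norm of \<open>v\<close> is zero and \<open>v\<close> vanishes
  on the space, or it is positive and finite and \<open>v\<close> can be normalised.\<close>

lemma factor_square_le:
  assumes m: "m \<in> {1..d}" and v: "v \<in> V m" and z: "z \<in> space (N m)"
  shows "ennreal ((v z)\<^sup>2) \<le>
    (SUP u\<in>{u \<in> V m. (\<integral>\<^sup>+ x. ennreal ((u x)\<^sup>2) \<partial>N m) = 1}. ennreal ((u z)\<^sup>2)) *
    (\<integral>\<^sup>+ x. ennreal ((v x)\<^sup>2) \<partial>N m)"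
proof -
  obtain s where s: "(\<integral>\<^sup>+ x. ennreal ((v x)\<^sup>2) \<partial>N m) = ennreal s" "0 \<le> s"
    using factor_square_finite[OF m v]
    by (cases "\<integral>\<^sup>+ x. ennreal ((v x)\<^sup>2) \<partial>N m") auto
  show ?thesis
  proof (cases "s = 0")
    case True
    then have "v z = 0" using factor_eq_0[OF m v _ z] s by simp
    then show ?thesis by simp
  next
    case False
    then have "0 < s" using s by simp
    let ?u = "(1 / sqrt s) *\<^sub>R v"
    note [measurable] = factor_measurable[OF m v]
    have sq: "ennreal ((?u x)\<^sup>2) = ennreal (1 / s) * ennreal ((v x)\<^sup>2)" for x
      using \<open>0 < s\<close> by (simp add: scaleR_fun_def power_divide flip: ennreal_mult)
    have "?u \<in> V m" by (rule subspace_scale[OF subspace_V[OF m] v])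
    moreover have "(\<integral>\<^sup>+ x. ennreal ((?u x)\<^sup>2) \<partial>N m) = ennreal (1 / s) * (\<integral>\<^sup>+ x. ennreal ((v x)\<^sup>2) \<partial>N m)"
      unfolding sq by (rule nn_integral_cmult) measurable
    then have "(\<integral>\<^sup>+ x. ennreal ((?u x)\<^sup>2) \<partial>N m) = 1"
      using \<open>0 < s\<close> by (simp add: s flip: ennreal_mult)
    ultimately have "ennreal ((?u z)\<^sup>2) \<le>
        (SUP u\<in>{u \<in> V m. (\<integral>\<^sup>+ x. ennreal ((u x)\<^sup>2) \<partial>N m) = 1}. ennreal ((u z)\<^sup>2))"
      by (intro SUP_upper) auto
    then have "ennreal ((?u z)\<^sup>2) * ennreal s \<le>
        (SUP u\<in>{u \<in> V m. (\<integral>\<^sup>+ x. ennreal ((u x)\<^sup>2) \<partial>N m) = 1}. ennreal ((u z)\<^sup>2)) * ennreal s"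
      by (rule mult_right_mono) simp
    moreover have "ennreal ((?u z)\<^sup>2) * ennreal s = ennreal ((v z)\<^sup>2)"
      using \<open>0 < s\<close> by (simp add: scaleR_fun_def power_divide flip: ennreal_mult)
    ultimately show ?thesis by (simp add: s)
  qed
qed

end

text \<open>Each slice of \<open>f\<close> lies in some \<open>V m\<close>, so \<open>f y\<close> is
  controlled by a product of one-dimensional suprema. A product of unit factors is a unit rank-1
  tensor, so \<open>K\<close> bounds that product.\<close>

lemma tensor_space_square_le:
  assumes f: "f \<in> tensor_space d N V" and y: "y \<in> space (PiM {1..d} N)"
    and K: "\<And>t. t \<in> rank1_tensors d N V \<Longrightarrow> L2norm (PiM {1..d} N) t = 1 \<Longrightarrow> ennreal ((t y)\<^sup>2) \<le> K"
  shows "ennreal ((f y)\<^sup>2) \<le> K * (\<integral>\<^sup>+ x. ennreal ((f x)\<^sup>2) \<partial>PiM {1..d} N)"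
\<comment> \<open>If all rank-1 tensors vanish, so does their span; otherwise a nonzero one supplies
  the probe \<open>v0\<close>, \<open>x0\<close>.\<close>
proof (cases "rank1_tensors d N V \<subseteq> {0}")
  case True
  then have "f = 0"
    using f span_minimal[OF True subspace_single_0] by (auto simp: tensor_space_def)
  then show ?thesis by simp
next
  case False
  then obtain v0 x0 where v0: "\<And>m. m \<in> {1..d} \<Longrightarrow> v0 m \<in> V m" and ne: "tensor d N v0 x0 \<noteq> 0"
    unfolding rank1_tensors_def by (fastforce simp: fun_eq_iff)
  from ne have x0: "x0 \<in> space (PiM {1..d} N)"
    by (auto simp: tensor_def split: if_splits)
  with ne have nonzero: "v0 m (x0 m) \<noteq> 0" if "m \<in> {1..d}" for m
    using that by (auto simp: tensor_apply prod_zero_iff)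
  define A where "A m = {u \<in> V m. (\<integral>\<^sup>+ x. ennreal ((u x)\<^sup>2) \<partial>N m) = 1}" for m
  have "f \<in> wspace F (PiM {1..d} N) w"
    using f span_minimal[OF rank1_subset subspace_wspace] by (auto simp: tensor_space_def)
  then have "f \<in> borel_measurable (PiM {1..d} N)" unfolding wspace_iff by blast
  then have "ennreal ((f y)\<^sup>2) \<le> (\<Prod>m\<in>{1..d}. SUP u\<in>A m. ennreal ((u (y m))\<^sup>2)) *
      (\<integral>\<^sup>+ x. ennreal ((f x)\<^sup>2) \<partial>PiM {1..d} N)"
  proof (rule square_le_prod_slices[rotated, OF _ y])
    fix m x assume m: "m \<in> {1..d}" and x: "x \<in> space (PiM {1..d} N)"
    from tensor_space_slice[where V = V, OF subspace_V[OF m] f m x]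
    obtain v where v: "v \<in> V m" "\<And>z. z \<in> space (N m) \<Longrightarrow> f (x(m := z)) = v z" by blast
    have ym: "y m \<in> space (N m)" using y m by (auto simp: space_PiM)
    have "ennreal ((v (y m))\<^sup>2) \<le> (SUP u\<in>A m. ennreal ((u (y m))\<^sup>2)) *
        (\<integral>\<^sup>+ z. ennreal ((v z)\<^sup>2) \<partial>N m)"
      unfolding A_def by (rule factor_square_le) (use v0 x0 nonzero m v(1) ym in blast)+
    moreover have "(\<integral>\<^sup>+ z. ennreal ((f (x(m := z)))\<^sup>2) \<partial>N m) = (\<integral>\<^sup>+ z. ennreal ((v z)\<^sup>2) \<partial>N m)"
      using v(2) by (intro nn_integral_cong) simp
    ultimately show "ennreal ((f (x(m := y m)))\<^sup>2) \<le> (SUP u\<in>A m. ennreal ((u (y m))\<^sup>2)) *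
        (\<integral>\<^sup>+ z. ennreal ((f (x(m := z)))\<^sup>2) \<partial>N m)"
      using v(2)[OF ym] by (simp del: fun_upd_apply)
  qed simp
  moreover have "(\<Prod>m\<in>{1..d}. SUP u\<in>A m. ennreal ((u (y m))\<^sup>2)) * 1 \<le> K"
  proof (rule prod_SUP_le_ennreal)
    fix v assume v: "\<And>m. m \<in> {1..d} \<Longrightarrow> v m \<in> A m"
    then have vV: "\<And>m. m \<in> {1..d} \<Longrightarrow> v m \<in> V m" by (auto simp: A_def)
    have "v m \<in> borel_measurable (N m)" if "m \<in> {1..d}" for m
      by (rule factor_measurable) (use v0 x0 nonzero vV that in blast)+
    then have "ennreal ((L2norm (PiM {1..d} N) (tensor d N v))\<^sup>2) = 1"
      using v nn_integral_square[OF tensor_in_wspace[OF vV]] nn_integral_tensor_square[of v]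
      by (simp add: A_def)
    then have "L2norm (PiM {1..d} N) (tensor d N v) = 1"
      by (simp add: L2norm_def)
    moreover have "tensor d N v \<in> rank1_tensors d N V"
      using vV by (auto simp: rank1_tensors_def)
    ultimately have "ennreal ((tensor d N v y)\<^sup>2) \<le> K" using K by blast
    then show "(\<Prod>m\<in>{1..d}. ennreal ((v m (y m))\<^sup>2)) * 1 \<le> K"
      using y by (simp add: tensor_apply prod_ennreal prod_power_distrib)
  qed simp
  ultimately show ?thesis
    unfolding mult_1_right by (blast intro: order_trans mult_right_mono zero_le)
qed

end

section \<open>Comparison of the two variation functions\<close>

theorem theorem8:
  fixes d :: nat
    and N :: "nat \<Rightarrow> 'a measure"
    and \<rho> :: "(nat \<Rightarrow> 'a) measure"
    and w :: "(nat \<Rightarrow> 'a) \<Rightarrow> real"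
    and F :: "((nat \<Rightarrow> 'a) \<Rightarrow> real) set"
    and V :: "nat \<Rightarrow> ('a \<Rightarrow> real) set"
    and \<M> :: "((nat \<Rightarrow> 'a) \<Rightarrow> real) set"
    and u u\<^sub>M u\<^sub>L :: "(nat \<Rightarrow> 'a) \<Rightarrow> real"
  assumes "1 \<le> d"
    and "\<And>m. m \<in> {1..d} \<Longrightarrow> prob_space (N m)"
    and "\<rho> = PiM {1..d} N"
    and "weight_function \<rho> w"
    and "has_point_evaluations F \<rho> w"
    and "\<And>m. m \<in> {1..d} \<Longrightarrow> subspace (V m)"
    and "\<M> \<subseteq> wspace F \<rho> w"
    and "conic_pos \<M>"
    and "symmetric_set \<M>"
    and "rank1_tensors d N V \<subseteq> wclosure F \<rho> w \<M>"
    and "wclosure F \<rho> w \<M> \<subseteq> tensor_space d N V"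
    and "u \<in> wspace F \<rho> w"
    and "best_approximation \<rho> u \<M> u\<^sub>M"
    and "best_approximation \<rho> u (span \<M>) u\<^sub>L"
  shows "\<forall>y\<in>space \<rho>. variation \<rho> ((\<lambda>v. u\<^sub>M - v) ` \<M>) y
                    = variation \<rho> ((\<lambda>v. u\<^sub>L - v) ` span \<M>) y"
proof
  fix y assume y: "y \<in> space \<rho>"
  \<comment> \<open>the locale needs probability measures at all indices, not only those in \<open>{1..d}\<close>\<close>
  define N' where "N' m = (if m \<in> {1..d} then N m else N 1)" for m
  have \<rho>: "\<rho> = PiM {1..d} N'"
    using assms(3) by (auto simp: N'_def intro!: PiM_cong)
  then have tensor: "tensor d N = tensor d N'"
    using assms(3) by (simp add: tensor_def fun_eq_iff)
  then have rank1: "rank1_tensors d N V = rank1_tensors d N' V"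
    by (simp add: rank1_tensors_def)
  interpret rank1_functions d N' w F V
  proof (intro rank1_functions.intro weighted_functions.intro rank1_functions_axioms.intro)
    show "weight_function (PiM {1..d} N') w" "has_point_evaluations F (PiM {1..d} N') w"
      using assms(4,5) \<rho> by auto
    \<comment> \<open>The filler \<open>N 1\<close> is a probability measure because
      \<open>1 \<le> d\<close>.\<close>
    show "prob_space (N' m)" for m using assms(1,2) by (simp add: N'_def)
    show "subspace (V m)" if "m \<in> {1..d}" for m using that assms(6) by simp
    show "rank1_tensors d N' V \<subseteq> wspace F (PiM {1..d} N') w"
      using assms(10) rank1 \<rho> by (auto simp: wclosure_def)
  qed
  have uM: "u\<^sub>M \<in> \<M>" and uL: "u\<^sub>L \<in> span \<M>"
    using assms(13,14) by (auto simp: best_approximation_def is_arg_min_def)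
  have span: "span \<M> \<subseteq> wspace F \<rho> w"
    using span_minimal[OF assms(7)] subspace_wspace \<rho> by simp
  \<comment> \<open>Shifting a subspace by one of its elements does not change it, so the right-hand
    variation is that of the span itself.\<close>
  have L: "(\<lambda>v. u\<^sub>L - v) ` span \<M> = span \<M>"
  proof (intro equalityI subsetI)
    fix v assume "v \<in> span \<M>"
    then have "u\<^sub>L - v \<in> span \<M>" using uL by (intro span_diff)
    then show "v \<in> (\<lambda>v. u\<^sub>L - v) ` span \<M>" by (intro image_eqI[of _ _ "u\<^sub>L - v"]) auto
  qed (use uL in \<open>auto intro: span_diff\<close>)
  have "\<M> \<subseteq> wclosure F \<rho> w \<M>"
  proof
    fix v assume v: "v \<in> \<M>"
    have "wnorm \<rho> w (v - v) \<le> ennreal 0"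
      unfolding \<rho> by (rule wnorm_le) (auto simp: zero_fun_def)
    then have "wnorm \<rho> w (v - v) < ennreal \<epsilon>" if "0 < \<epsilon>" for \<epsilon>
      using that by simp
    then show "v \<in> wclosure F \<rho> w \<M>"
      using v assms(7) unfolding wclosure_def by blast
  qed
  then have "span \<M> \<subseteq> tensor_space d N' V"
    using assms(11) unfolding tensor_space_def rank1 by (intro span_minimal) auto
  \<comment> \<open>The nontrivial inequality: the span lies in the tensor product, whose values are
    controlled by unit rank-1 tensors, and these lie in the closure of the cone, so the shifted cone
    dominates them.\<close>
  have "variation \<rho> (span \<M>) y \<le> variation \<rho> ((\<lambda>v. u\<^sub>M - v) ` \<M>) y"
    unfolding \<rho>
  proof (rule variation_le)
    show "span \<M> \<subseteq> wspace F (PiM {1..d} N') w" using span \<rho> by simp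
    fix f assume "f \<in> span \<M>"
    show "ennreal ((f y)\<^sup>2) \<le> variation (PiM {1..d} N') ((\<lambda>v. u\<^sub>M - v) ` \<M>) y *
        (\<integral>\<^sup>+ x. ennreal ((f x)\<^sup>2) \<partial>PiM {1..d} N')"
    proof (rule tensor_space_square_le)
      show "f \<in> tensor_space d N' V"
        using \<open>f \<in> span \<M>\<close> \<open>span \<M> \<subseteq> tensor_space d N' V\<close> by auto
      show "y \<in> space (PiM {1..d} N')" using y \<rho> by simp
      fix t assume "t \<in> rank1_tensors d N' V" "L2norm (PiM {1..d} N') t = 1"
      then show "ennreal ((t y)\<^sup>2) \<le> variation (PiM {1..d} N') ((\<lambda>v. u\<^sub>M - v) ` \<M>) y"
        using assms(7,8,10) uM y unfolding rank1 \<rho>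
        by (intro variation_shifted_cone_ge) auto
    qed
  qed
  \<comment> \<open>Since \<open>u\<^sub>M\<close> belongs to the cone, the shifted cone is
    contained in the span.\<close>
  moreover have "variation \<rho> ((\<lambda>v. u\<^sub>M - v) ` \<M>) y \<le> variation \<rho> (span \<M>) y"
    using uM by (intro variation_mono) (auto intro: span_diff span_base)
  ultimately show "variation \<rho> ((\<lambda>v. u\<^sub>M - v) ` \<M>) y
                 = variation \<rho> ((\<lambda>v. u\<^sub>L - v) ` span \<M>) y"
    unfolding L by (rule antisym[rotated])
qed

end
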